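(* Let $n\ge1$ be an even number and $u=n+\sqrt{n^2-1}$. Then $$\mathcal{J}_1(u)=\frac{1}{u-1}C(u)-\frac{2\gamma}{u+1}+\frac{u^2+1}{u(u+1)}\log(2)-\frac{2}{u+1}\log\left(\frac{u-1}{u+1}\right),$$ where $$C(u)=\widetilde{P}\left(u,\frac1u\right)-2\widetilde{P}\left(\frac{u+1}{2},\frac{u+1}{2u}\right)-2\widetilde{P}\left(\frac{2u}{u+1},\frac{2}{u+1}\right)$$ and $$\widetilde{P}(x,y)=\mathcal{F}_1(x)-\mathcal{F}_1(y)-\frac{x-y}{2xy}\left(\gamma+\log\left(\frac{x-y}{xy}\right)\right).$$
   Context: For $x\in\mathbb{C}\setminus(-\infty,0]$, let $$\mathcal{F}_1(x)=\sum_{n=1}^\infty\left\{\psi(nx)+\frac{1}{2nx}-\log(nx)\right\}-\frac12\left(\gamma-\log\left(\frac{2\pi}{x}\right)\right),$$ where $\psi=\Gamma'/\Gamma$ is the digamma function, $\gamma$ is Euler's constant, and $\log$ is the principal branch. For $\mathrm{Re}(x)>0$, let $$J_1(x)=\int_0^\infty\frac{dt}{(1+e^{-t})(1+e^{xt})},\qquad\mathcal{J}_1(x)=J_1(x)+\log(2).$$ *)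

theory Defs
  imports "HOL-Analysis.Analysis"
begin

text \<open>
  All functions are total on \<^typ>\<open>complex\<close>. They carry their intended meaning only on the
  stated domains: \<open>\<F>\<^sub>1\<close> off the half-line of nonpositive reals, \<open>J\<^sub>1\<close> on the half-plane
  \<open>Re x > 0\<close>. On complex arguments, \<^const>\<open>ln\<close> is the principal branch.
\<close>

text \<open>The summation index is shifted: \<open>n\<close> in the formula is \<open>Suc k\<close> here.\<close>

definition herglotz_F1 :: "complex \<Rightarrow> complex" where
  "herglotz_F1 x =
     (\<Sum>k. Digamma (of_nat (Suc k) * x) + 1 / (2 * of_nat (Suc k) * x) - ln (of_nat (Suc k) * x))
     - 1 / 2 * (euler_mascheroni - ln (2 * of_real pi / x))"

definition J1 :: "complex \<Rightarrow> complex" where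
  "J1 x = (LINT t:{0<..}|lborel. 1 / ((1 + exp (- of_real t)) * (1 + exp (x * of_real t))))"

definition calJ1 :: "complex \<Rightarrow> complex" where
  "calJ1 x = J1 x + ln 2"

definition P_tilde :: "complex \<Rightarrow> complex \<Rightarrow> complex" where
  "P_tilde x y = herglotz_F1 x - herglotz_F1 y
     - (x - y) / (2 * x * y) * (euler_mascheroni + ln ((x - y) / (x * y)))"

definition C_comb :: "complex \<Rightarrow> complex" where
  "C_comb u = P_tilde u (1 / u) - 2 * P_tilde ((u + 1) / 2) ((u + 1) / (2 * u))
     - 2 * P_tilde (2 * u / (u + 1)) (2 / (u + 1))"

end

theory Submission
  imports Defs "HOL-Real_Asymp.Real_Asymp"
begin

text \<open>
  The identity is proved for every real \<open>u > 1\<close>. It is a statement about lattice sums. Let \<open>A(x)\<close> and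
  \<open>J\<^sub>1(u)\<close> be the integrals over \<open>t > 0\<close> of \<open>1 / ((1 - e^(-t)) (e^(xt) - 1))\<close> and of
  \<open>1 / ((1 + e^(-t)) (1 + e^(ut)))\<close>, and formally expand all factors in geometric series.
  Then \<open>A(x)\<close> is the sum of \<open>1/(i + j x)\<close> over \<open>i \<ge> 0\<close>, \<open>j \<ge> 1\<close>, and \<open>- J\<^sub>1(u)\<close> is the same sum at
  \<open>x = u\<close> weighted by \<open>(-1)^(i + j)\<close>. Hence \<open>J\<^sub>1(u)\<close> is \<open>A(u)\<close> minus twice the part of \<open>A(u)\<close> with
  \<open>i \<equiv> j\<close> modulo 2. That part splits into \<open>i \<ge> j\<close>, which is half of \<open>A((u + 1) / 2)\<close>, and \<open>i \<le> j\<close>,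
  which is half of \<open>A((u + 1) / (2u)) / u\<close>, up to the diagonal and the axis \<open>i = 0\<close>.

  The integrals \<open>A(x)\<close> diverge at 0. Replacing \<open>1 / (1 - e^(-t))\<close> by \<open>1 / (1 - e^(-t)) - 1/t - 1/2\<close>,
  the kernel of Binet's formula for the digamma function, makes \<open>A(x)\<close> converge, and its value is
  then minus the digamma series in \<open>\<F>\<^sub>1(x)\<close> (\<open>Digamma_binet\<close>, \<open>herglotz_kernel_sums\<close>).
  Identities between the regularised integrals are proved on \<open>{\<epsilon><..}\<close>, where every summand
  is integrable on its own, and the divergent terms are matched as \<open>\<epsilon>\<close> tends to 0. Two functions of
  \<open>\<epsilon>\<close> occur: the tails of \<open>1 / (e^t - 1)\<close>, known in closed form, and of \<open>1 / (t (e^t - 1))\<close>,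
  whose expansion at 0 involves a constant \<open>c\<close>.

  In this way, \<open>herglotz_kernel_inversion\<close> relates \<open>A(x)\<close> to \<open>A(1/x) / x\<close> (by the symmetry
  of the double sum in \<open>i\<close> and \<open>j\<close>), and \<open>parity_integral_decomposition\<close> makes the splitting of
  \<open>J\<^sub>1(u)\<close> precise. The inversion turns \<open>C(u) / (u - 1)\<close> into
  \<open>A(u) - A((u + 1) / 2) - A((u + 1) / (2u)) / u\<close> plus elementary terms. Here
  and in \<open>J\<^sub>1(u)\<close>, \<open>c\<close> enters as \<open>- c / u\<close>, so it cancels.
\<close>

section \<open>Tail integrals\<close>

abbreviation tail_integral :: "(real \<Rightarrow> real) \<Rightarrow> real \<Rightarrow> real" where
  "tail_integral h \<epsilon> \<equiv> (LINT t:{\<epsilon><..}|lborel. h t)"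

lemma tail_integral_FTC_nonneg:
  fixes f F :: "real \<Rightarrow> real"
  assumes F: "\<And>t. t > a \<Longrightarrow> (F has_real_derivative f t) (at t)"
    and cont: "\<And>t. t > a \<Longrightarrow> isCont f t"
    and nonneg: "\<And>t. t > a \<Longrightarrow> f t \<ge> 0"
    and lower: "(F \<longlongrightarrow> L) (at_right a)" and upper: "(F \<longlongrightarrow> U) at_top"
  shows "set_integrable lborel {a<..} f" and "tail_integral f a = U - L"
proof -
  have *: "((F \<circ> real_of_ereal) \<longlongrightarrow> L) (at_right (ereal a))" "((F \<circ> real_of_ereal) \<longlongrightarrow> U) (at_left \<infinity>)"
    using lower upper by (simp_all add: ereal_tendsto_simps)
  have e: "einterval (ereal a) \<infinity> = {a<..}"
    by (auto simp: einterval_def)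
  note I = interval_integral_FTC_nonneg[of "ereal a" \<infinity> F f L U]
  show "set_integrable lborel {a<..} f"
    using I(1) * e assms by auto
  have "(LBINT x=ereal a..\<infinity>. f x) = U - L"
    by (rule I(2)) (use * assms in auto)
  thus "tail_integral f a = U - L"
    by (simp add: interval_lebesgue_integral_def e)
qed

lemma tail_integral_scale:
  fixes h :: "real \<Rightarrow> real"
  assumes "x > 0"
  shows "tail_integral (\<lambda>t. h (x * t)) \<epsilon> = tail_integral h (x * \<epsilon>) / x"
proof -
  have ind: "indicator {x * \<epsilon><..} (x * t) = (indicator {\<epsilon><..} t :: real)" for t
    using assms by (simp add: indicator_def)
  show ?thesis
    using assms unfolding set_lebesgue_integral_def
    by (subst (2) lborel_integral_real_affine[of x _ 0]) (simp_all add: ind)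
qed

lemma set_integrable_scale:
  fixes h :: "real \<Rightarrow> real"
  assumes "x > 0" "set_integrable lborel {x * \<epsilon><..} h"
  shows "set_integrable lborel {\<epsilon><..} (\<lambda>t. h (x * t))"
proof -
  have ind: "indicator {x * \<epsilon><..} (x * t) = (indicator {\<epsilon><..} t :: real)" for t
    using assms(1) by (simp add: indicator_def)
  show ?thesis
    using lborel_integrable_real_affine[OF assms(2)[unfolded set_integrable_def], of x 0] assms(1)
    by (simp add: set_integrable_def ind)
qed

lemma tail_integral_tendsto:
  assumes int: "set_integrable lborel {0<..} h"
  shows "(tail_integral h \<longlongrightarrow> tail_integral h 0) (at_right 0)"
proof (rule tendsto_at_right_sequentially[of 0 1])
  fix S :: "nat \<Rightarrow> real"
  assume S: "\<And>n. 0 < S n" "S \<longlonglongrightarrow> 0"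
  have m: "(\<lambda>t. indicator {0<..} t *\<^sub>R h t) \<in> borel_measurable lborel"
    using int by (simp add: set_integrable_def borel_measurable_integrable)
  have eq: "indicator {S n<..} t *\<^sub>R h t = indicator {S n<..} t *\<^sub>R (indicator {0<..} t *\<^sub>R h t)" for n t
    using S(1)[of n] by (auto simp: indicator_def)
  show "(\<lambda>n. tail_integral h (S n)) \<longlonglongrightarrow> tail_integral h 0"
    unfolding set_lebesgue_integral_def
  proof (rule integral_dominated_convergence[where w = "\<lambda>t. norm (indicator {0<..} t *\<^sub>R h t)"])
    show "(\<lambda>t. indicator {S n<..} t *\<^sub>R h t) \<in> borel_measurable lborel" for n
      unfolding eq using m by measurable
    show "integrable lborel (\<lambda>t. norm (indicator {0<..} t *\<^sub>R h t))"
      using int unfolding set_integrable_def by (rule integrable_norm)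
    show "AE t in lborel. norm (indicator {S n<..} t *\<^sub>R h t) \<le> norm (indicator {0<..} t *\<^sub>R h t)" for n
      using S(1)[of n] by (auto simp: indicator_def)
    show "AE t in lborel. (\<lambda>n. indicator {S n<..} t *\<^sub>R h t) \<longlonglongrightarrow> indicator {0<..} t *\<^sub>R h t"
    proof (rule AE_I2)
      fix t :: real
      show "(\<lambda>n. indicator {S n<..} t *\<^sub>R h t) \<longlonglongrightarrow> indicator {0<..} t *\<^sub>R h t"
      proof (cases "t > 0")
        case True
        hence "eventually (\<lambda>n. S n < t) sequentially"
          using S(2) by (simp add: order_tendstoD)
        hence "eventually (\<lambda>n. indicator {S n<..} t *\<^sub>R h t = indicator {0<..} t *\<^sub>R h t) sequentially"
          by eventually_elim (use True in auto)
        thus ?thesis by (rule tendsto_eventually)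
      next
        case False
        hence "t \<notin> {S n<..}" for n using S(1)[of n] by auto
        with False show ?thesis by simp
      qed
    qed
  qed (use m in auto)
qed auto

text \<open>
  Subtracting the singular part \<open>\<alpha> / t\<^sup>2 + \<beta> / t\<close> on \<open>{0<..1}\<close> leaves a function integrable up to 0,
  and the subtracted part has an elementary primitive. The constant \<open>c\<close> is left implicit: in
  every application it cancels.
\<close>

lemma tail_integral_asymptotics:
  fixes h :: "real \<Rightarrow> real"
  assumes [measurable]: "h \<in> borel_measurable borel"
    and int: "set_integrable lborel {1<..} h"
    and bound: "\<And>t. 0 < t \<Longrightarrow> t \<le> 1 \<Longrightarrow> \<bar>h t - \<alpha> / t\<^sup>2 - \<beta> / t\<bar> \<le> B"
  shows "\<exists>c. ((\<lambda>\<epsilon>. tail_integral h \<epsilon> - \<alpha> / \<epsilon> + \<beta> * ln \<epsilon>) \<longlongrightarrow> c) (at_right 0)"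
proof -
  (* s is the singular part, w the remainder, which is integrable on all of {0<..} *)
  define s where "s t = \<alpha> / t\<^sup>2 + \<beta> / t" for t :: real
  define w where "w t = h t - s t * indicator {..1} t" for t
  have [measurable]: "s \<in> borel_measurable borel" "w \<in> borel_measurable borel"
    unfolding s_def w_def by measurable
  have "set_integrable lborel {0<..1::real} (\<lambda>_. B)"
    by (simp add: set_integrable_def)
  hence "set_integrable lborel {0<..1} w"
  proof (rule set_integrable_bound)
    have "\<bar>w t\<bar> \<le> \<bar>B\<bar>" if "t \<in> {0<..1}" for t
    proof -
      have "w t = h t - \<alpha> / t\<^sup>2 - \<beta> / t"
        using that by (simp add: w_def s_def)
      thus ?thesis using bound[of t] that by simp
    qed
    thus "AE t in lborel. t \<in> {0<..1} \<longrightarrow> norm (w t) \<le> norm B"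
      by (intro AE_I2) auto
  qed (simp add: set_borel_measurable_def)
  moreover have "set_integrable lborel {1<..} w \<longleftrightarrow> set_integrable lborel {1<..} h"
    by (rule set_integrable_cong) (auto simp: w_def)
  ultimately have "set_integrable lborel ({0<..1} \<union> {1<..}) w"
    using int by (intro set_integrable_Un) auto
  also have "{0<..1} \<union> {1<..} = {0::real<..}" by auto
  finally have w0: "set_integrable lborel {0<..} w" .
  have eq: "tail_integral h \<epsilon> - \<alpha> / \<epsilon> + \<beta> * ln \<epsilon> = tail_integral w \<epsilon> - \<alpha>" if "0 < \<epsilon>" "\<epsilon> < 1" for \<epsilon>
  proof -
    have w\<epsilon>: "set_integrable lborel {\<epsilon><..} w"
      by (rule set_integrable_subset[OF w0]) (use that in auto)
    have "has_bochner_integral lborel (\<lambda>t. s t * indicator {\<epsilon>..1} t)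
        ((- \<alpha> / 1 + \<beta> * ln 1) - (- \<alpha> / \<epsilon> + \<beta> * ln \<epsilon>))"
    proof (rule has_bochner_integral_FTC_Icc_real)
      fix t assume "\<epsilon> \<le> t" "t \<le> 1"
      thus "((\<lambda>t. - \<alpha> / t + \<beta> * ln t) has_real_derivative s t) (at t)"
        using that by (auto intro!: derivative_eq_intros simp: s_def power2_eq_square field_simps)
      show "isCont s t"
        using that \<open>\<epsilon> \<le> t\<close> unfolding s_def by (intro continuous_intros) auto
    qed (use that in auto)
    also have "(- \<alpha> / 1 + \<beta> * ln 1) - (- \<alpha> / \<epsilon> + \<beta> * ln \<epsilon>) = \<alpha> / \<epsilon> - \<alpha> - \<beta> * ln \<epsilon>"
      by simp
    also have "has_bochner_integral lborel (\<lambda>t. s t * indicator {\<epsilon>..1} t) (\<alpha> / \<epsilon> - \<alpha> - \<beta> * ln \<epsilon>)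
        \<longleftrightarrow> has_bochner_integral lborel (\<lambda>t. indicator {\<epsilon><..} t *\<^sub>R (s t * indicator {..1} t))
              (\<alpha> / \<epsilon> - \<alpha> - \<beta> * ln \<epsilon>)"
      using AE_lborel_singleton[of \<epsilon>]
      by (intro has_bochner_integral_cong_AE) (auto simp: indicator_def elim!: eventually_mono)
    finally have "has_bochner_integral lborel (\<lambda>t. indicator {\<epsilon><..} t *\<^sub>R (s t * indicator {..1} t))
        (\<alpha> / \<epsilon> - \<alpha> - \<beta> * ln \<epsilon>)" .
    hence s\<epsilon>: "set_integrable lborel {\<epsilon><..} (\<lambda>t. s t * indicator {..1} t)"
      and s\<epsilon>': "tail_integral (\<lambda>t. s t * indicator {..1} t) \<epsilon> = \<alpha> / \<epsilon> - \<alpha> - \<beta> * ln \<epsilon>"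
      by (auto simp: has_bochner_integral_iff set_integrable_def set_lebesgue_integral_def)
    have "tail_integral h \<epsilon> = tail_integral (\<lambda>t. w t + s t * indicator {..1} t) \<epsilon>"
      by (simp add: w_def)
    also have "\<dots> = tail_integral w \<epsilon> + (\<alpha> / \<epsilon> - \<alpha> - \<beta> * ln \<epsilon>)"
      using set_integral_add(2)[OF w\<epsilon> s\<epsilon>] s\<epsilon>' by simp
    finally show ?thesis by simp
  qed
  have "((\<lambda>\<epsilon>. tail_integral w \<epsilon> - \<alpha>) \<longlongrightarrow> tail_integral w 0 - \<alpha>) (at_right 0)"
    by (intro tendsto_intros tail_integral_tendsto w0)
  moreover have "eventually (\<lambda>\<epsilon>. tail_integral w \<epsilon> - \<alpha> = tail_integral h \<epsilon> - \<alpha> / \<epsilon> + \<beta> * ln \<epsilon>) (at_right 0)"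
    unfolding eventually_at_right_field by (intro exI[of _ 1] conjI allI impI eq[symmetric]) auto
  ultimately have "((\<lambda>\<epsilon>. tail_integral h \<epsilon> - \<alpha> / \<epsilon> + \<beta> * ln \<epsilon>) \<longlongrightarrow> tail_integral w 0 - \<alpha>) (at_right 0)"
    by (rule Lim_transform_eventually)
  thus ?thesis ..
qed

section \<open>The Bose function and the Binet kernel\<close>

text \<open>
  The geometric series of the \<open>e^(-jt)\<close> over \<open>j \<ge> 1\<close>. Over \<open>j \<ge> 0\<close>, the sum is \<open>1 + bose t\<close>, that is
  \<open>1 / (1 - e^(-t))\<close>.
\<close>

definition bose :: "real \<Rightarrow> real" where
  "bose t = 1 / (exp t - 1)"

text \<open>
  The series over \<open>j \<ge> 0\<close> without the terms \<open>1/t + 1/2\<close> of its expansion at 0, so that it vanishes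
  there to first order.
\<close>

definition binet_kernel :: "real \<Rightarrow> real" where
  "binet_kernel t = 1 / (1 - exp (- t)) - 1 / t - 1 / 2"

lemma borel_measurable_bose [measurable]: "bose \<in> borel_measurable borel"
  unfolding bose_def by measurable

lemma borel_measurable_binet_kernel [measurable]: "binet_kernel \<in> borel_measurable borel"
  unfolding binet_kernel_def by measurable

lemma binet_kernel_eq_bose:
  assumes "t > 0"
  shows "binet_kernel t = bose t + 1 / 2 - 1 / t"
proof -
  have "exp t > 1" using assms by simp
  thus ?thesis by (simp add: binet_kernel_def bose_def exp_minus field_simps)
qed

text \<open>
  Multiplied by the positive \<open>t (1 - e^(-t))\<close>, the kernel becomes the function \<open>r\<close> of the proof,
  which vanishes at 0 and increases because \<open>1 + s \<le> e^s\<close>.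
\<close>

lemma binet_kernel_nonneg:
  assumes "t > 0"
  shows "binet_kernel t \<ge> 0"
proof -
  define r where "r s = exp (- s) * (1 + s / 2) - 1 + s / 2" for s :: real
  have "r 0 \<le> r t"
  proof (rule DERIV_nonneg_imp_nondecreasing[of 0 t r])
    fix s :: real assume "0 \<le> s"
    have "(r has_real_derivative (1 - (1 + s) * exp (- s)) / 2) (at s)"
      unfolding r_def by (auto intro!: derivative_eq_intros simp: field_simps)
    moreover have "(1 + s) * exp (- s) \<le> exp s * exp (- s)"
      by (intro mult_right_mono) auto
    hence "(1 - (1 + s) * exp (- s)) / 2 \<ge> 0" by (simp flip: exp_add)
    ultimately show "\<exists>y. (r has_real_derivative y) (at s) \<and> 0 \<le> y" by blast
  qed (use assms in auto)
  hence "t - (1 - exp (- t)) * (1 + t / 2) \<ge> 0"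
    by (simp add: r_def field_simps)
  moreover have "1 - exp (- t) > 0" using assms by simp
  moreover have "binet_kernel t = (t - (1 - exp (- t)) * (1 + t / 2)) / (t * (1 - exp (- t)))"
    using assms \<open>1 - exp (- t) > 0\<close> by (simp add: binet_kernel_def field_simps)
  ultimately show ?thesis using assms by simp
qed

lemma binet_kernel_le_half:
  assumes "t > 0"
  shows "binet_kernel t \<le> 1 / 2"
proof -
  have "t \<le> exp t - 1" using exp_ge_add_one_self[of t] by linarith
  hence "1 / (exp t - 1) \<le> 1 / t" using assms by (intro divide_left_mono) auto
  thus ?thesis using assms by (simp add: binet_kernel_eq_bose bose_def)
qed

text \<open>
  For \<open>t \<le> 1\<close>, the quadratic Taylor bounds suffice: \<open>1 + t + t\<^sup>2/2 \<le> e^t\<close> gives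
  \<open>e^(-t) \<le> 1 - t + t\<^sup>2/2\<close>, as the product of the two polynomials is \<open>1 + t^4/4\<close>. For larger \<open>t\<close>,
  the bound \<open>1/2\<close> is stronger.
\<close>

lemma binet_kernel_le_linear:
  assumes "t > 0"
  shows "binet_kernel t \<le> t / 2"
proof (cases "t \<le> 1")
  case False
  thus ?thesis using binet_kernel_le_half[OF assms] by simp
next
  case True
  have pos: "1 - exp (- t) > 0" using assms by simp
  have "1 + t + t\<^sup>2 / 2 \<le> exp t" using exp_lower_Taylor_quadratic[of t] assms by simp
  have "exp (- t) \<le> 1 - t + t\<^sup>2 / 2"
  proof -
    have "(1 - t + t\<^sup>2 / 2) * (1 + t + t\<^sup>2 / 2) = 1 + t ^ 4 / 4"
      by (simp add: algebra_simps power2_eq_square power4_eq_xxxx)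
    hence "1 \<le> (1 - t + t\<^sup>2 / 2) * (1 + t + t\<^sup>2 / 2)" by simp
    also have "\<dots> \<le> (1 - t + t\<^sup>2 / 2) * exp t"
      using True \<open>1 + t + t\<^sup>2 / 2 \<le> exp t\<close> by (intro mult_left_mono) auto
    finally show ?thesis by (simp add: exp_minus field_simps)
  qed
  hence "(t - t\<^sup>2 / 2) * (1 + t / 2 + t\<^sup>2 / 2) \<le> (1 - exp (- t)) * (1 + t / 2 + t\<^sup>2 / 2)"
    using assms by (intro mult_right_mono) auto
  moreover have "(t - t\<^sup>2 / 2) * (1 + t / 2 + t\<^sup>2 / 2) = t + t ^ 3 * (1 - t) / 4"
    by (simp add: field_simps power2_eq_square power3_eq_cube)
  moreover have "t ^ 3 * (1 - t) / 4 \<ge> 0" using True assms by simp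
  ultimately have "t \<le> (1 - exp (- t)) * (1 + t / 2 + t\<^sup>2 / 2)" by linarith
  hence "1 / (1 - exp (- t)) \<le> (1 + t / 2 + t\<^sup>2 / 2) / t"
    using pos assms by (simp add: field_simps)
  thus ?thesis using assms by (simp add: binet_kernel_def field_simps power2_eq_square)
qed

lemma bose_bound:
  assumes "t > 0"
  shows "0 < bose t" "bose t \<le> 2 / t * exp (- t / 2)"
proof -
  show "0 < bose t" using assms by (simp add: bose_def)
  have pos: "1 - exp (- t) > 0" using assms by simp
  have "bose t = 1 / (1 - exp (- t)) * exp (- t)"
    using assms pos by (simp add: bose_def exp_minus field_simps)
  also have "\<dots> \<le> (1 / t + 1) * exp (- t)"
    using binet_kernel_le_half[OF assms] by (intro mult_right_mono) (auto simp: binet_kernel_def)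
  also have "\<dots> \<le> (2 / t * exp (t / 2)) * exp (- t)"
  proof (intro mult_right_mono)
    have "1 + t \<le> 2 * exp (t / 2)" using exp_ge_add_one_self[of "t / 2"] assms by linarith
    hence "(1 + t) / t \<le> (2 * exp (t / 2)) / t" using assms by (intro divide_right_mono) auto
    thus "1 / t + 1 \<le> 2 / t * exp (t / 2)" using assms by (simp add: add_divide_distrib)
  qed auto
  also have "\<dots> = 2 / t * exp (- t / 2)" by (simp flip: exp_add)
  finally show "bose t \<le> 2 / t * exp (- t / 2)" .
qed

section \<open>Exponential integrals\<close>

lemma exp_tail_integral:
  fixes c :: real
  assumes "c > 0"
  shows "set_integrable lborel {a<..} (\<lambda>t. exp (- (c * t)))"
    and "tail_integral (\<lambda>t. exp (- (c * t))) a = exp (- (c * a)) / c"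
proof -
  have lower: "((\<lambda>t. - exp (- (c * t)) / c) \<longlongrightarrow> - exp (- (c * a)) / c) (at_right a)"
    using assms by (intro tendsto_intros) auto
  have upper: "((\<lambda>t. - exp (- (c * t)) / c) \<longlongrightarrow> 0) at_top"
    using assms by real_asymp
  have F: "((\<lambda>t. - exp (- (c * t)) / c) has_real_derivative exp (- (c * t))) (at t)" for t
    using assms by (auto intro!: derivative_eq_intros)
  show "set_integrable lborel {a<..} (\<lambda>t. exp (- (c * t)))"
    by (rule tail_integral_FTC_nonneg(1)[OF F _ _ lower upper]) auto
  have "tail_integral (\<lambda>t. exp (- (c * t))) a = 0 - (- exp (- (c * a)) / c)"
    by (rule tail_integral_FTC_nonneg(2)[OF F _ _ lower upper]) auto
  thus "tail_integral (\<lambda>t. exp (- (c * t))) a = exp (- (c * a)) / c"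
    by simp
qed

lemma bose_tail_integral:
  assumes "a > 0"
  shows "set_integrable lborel {a<..} bose"
    and "tail_integral bose a = - ln (1 - exp (- a))"
proof -
  have lower: "((\<lambda>t. ln (1 - exp (- t))) \<longlongrightarrow> ln (1 - exp (- a))) (at_right a)"
    using assms by (intro tendsto_intros) auto
  have upper: "((\<lambda>t::real. ln (1 - exp (- t))) \<longlongrightarrow> 0) at_top"
    by real_asymp
  have F: "((\<lambda>t. ln (1 - exp (- t))) has_real_derivative bose t) (at t)" if "t > a" for t
    using assms that
    by (auto intro!: derivative_eq_intros simp: bose_def exp_minus field_simps)
  have cont: "isCont bose t" if "t > a" for t
    using assms that unfolding bose_def by (intro continuous_intros) auto
  have nonneg: "bose t \<ge> 0" if "t > a" for t
    using bose_bound(1)[of t] assms that by simp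
  show "set_integrable lborel {a<..} bose"
    by (rule tail_integral_FTC_nonneg(1)[OF F cont nonneg lower upper])
  have "tail_integral bose a = 0 - ln (1 - exp (- a))"
    by (rule tail_integral_FTC_nonneg(2)[OF F cont nonneg lower upper])
  thus "tail_integral bose a = - ln (1 - exp (- a))"
    by simp
qed

lemma set_integrable_dominated:
  fixes f g :: "real \<Rightarrow> real"
  assumes "set_integrable lborel {a<..} f" "g \<in> borel_measurable borel"
    and "\<And>t. t > a \<Longrightarrow> \<bar>g t\<bar> \<le> f t"
  shows "set_integrable lborel {a<..} g"
proof (rule set_integrable_bound[OF assms(1)])
  show "set_borel_measurable lborel {a<..} g"
    using assms(2) by (simp add: set_borel_measurable_def)
  show "AE t in lborel. t \<in> {a<..} \<longrightarrow> norm (g t) \<le> norm (f t)"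
    using assms(3) by (force intro!: AE_I2)
qed

text \<open>
  Both exponentials are rescalings of \<open>e^(-t) / t\<close>, whose tail is \<open>c - ln \<epsilon> + o(1)\<close>. Rescaling moves
  only the cutoff, so \<open>c\<close> drops out of the difference and the logarithms remain.
\<close>

lemma frullani_exp:
  fixes x y :: real
  assumes x: "0 < x" and xy: "x \<le> y"
  shows "set_integrable lborel {0<..} (\<lambda>t. (exp (- (x * t)) - exp (- (y * t))) / t)"
    and "tail_integral (\<lambda>t. (exp (- (x * t)) - exp (- (y * t))) / t) 0 = ln (y / x)"
proof -
  have y: "y > 0" using assms by simp
  let ?f = "\<lambda>t. (exp (- (x * t)) - exp (- (y * t))) / t"
  have "set_integrable lborel {0<..} (\<lambda>t. (y - x) * exp (- (x * t)))"
    using exp_tail_integral(1)[OF x] by simp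
  thus int: "set_integrable lborel {0<..} ?f"
  proof (rule set_integrable_dominated)
    fix t :: real assume t: "t > 0"
    have "exp (- (x * t)) - exp (- (y * t)) = exp (- (x * t)) * (1 - exp (- ((y - x) * t)))"
      by (simp add: algebra_simps flip: exp_add)
    also have "\<dots> \<le> exp (- (x * t)) * ((y - x) * t)"
      using exp_ge_add_one_self[of "- ((y - x) * t)"] by (intro mult_left_mono) auto
    finally have "?f t \<le> exp (- (x * t)) * ((y - x) * t) / t"
      using t by (intro divide_right_mono) auto
    moreover have "?f t \<ge> 0" using t xy by simp
    ultimately show "\<bar>?f t\<bar> \<le> (y - x) * exp (- (x * t))"
      using t by (simp add: mult_ac)
  qed measurable
  let ?h = "\<lambda>t::real. exp (- t) / t"
  have h_int: "set_integrable lborel {a<..} ?h" if "a > 0" for a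
  proof (rule set_integrable_dominated)
    show "set_integrable lborel {a<..} (\<lambda>t. 1 / a * exp (- (1 * t)))"
      using exp_tail_integral(1)[of 1 a] by simp
    show "\<bar>exp (- t) / t\<bar> \<le> 1 / a * exp (- (1 * t))" if "t > a" for t
      using that \<open>a > 0\<close> by (simp add: field_simps)
  qed measurable
  have "\<exists>c. ((\<lambda>\<epsilon>. tail_integral ?h \<epsilon> - 0 / \<epsilon> + 1 * ln \<epsilon>) \<longlongrightarrow> c) (at_right 0)"
  proof (rule tail_integral_asymptotics)
    fix t :: real assume t: "0 < t" "t \<le> 1"
    have "1 - exp (- t) \<le> t" "1 - exp (- t) \<ge> 0"
      using exp_ge_add_one_self[of "- t"] t by auto
    moreover have "exp (- t) / t - 0 / t\<^sup>2 - 1 / t = - ((1 - exp (- t)) / t)"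
      using t by (simp add: field_simps)
    ultimately show "\<bar>exp (- t) / t - 0 / t\<^sup>2 - 1 / t\<bar> \<le> 1"
      using t by simp
  qed (use h_int in auto)
  then obtain c where c: "((\<lambda>\<epsilon>. tail_integral ?h \<epsilon> + ln \<epsilon>) \<longlongrightarrow> c) (at_right 0)"
    by auto
  have c': "((\<lambda>\<epsilon>. tail_integral ?h (z * \<epsilon>) + ln (z * \<epsilon>)) \<longlongrightarrow> c) (at_right 0)" if "z > 0" for z
    by (rule filterlim_compose[OF c]) (use that in real_asymp)
  have eq: "tail_integral ?f \<epsilon> = (tail_integral ?h (x * \<epsilon>) + ln (x * \<epsilon>))
      - (tail_integral ?h (y * \<epsilon>) + ln (y * \<epsilon>)) + ln (y / x)" if \<epsilon>: "\<epsilon> > 0" for \<epsilon>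
  proof -
    have s: "set_integrable lborel {\<epsilon><..} (\<lambda>t. z * ?h (z * t))"
      "tail_integral (\<lambda>t. z * ?h (z * t)) \<epsilon> = tail_integral ?h (z * \<epsilon>)" if "z > 0" for z
    proof -
      have "set_integrable lborel {\<epsilon><..} (\<lambda>t. ?h (z * t))"
        by (rule set_integrable_scale[OF that h_int]) (use that \<epsilon> in simp)
      thus "set_integrable lborel {\<epsilon><..} (\<lambda>t. z * ?h (z * t))"
        by (rule set_integrable_mult_right)
      show "tail_integral (\<lambda>t. z * ?h (z * t)) \<epsilon> = tail_integral ?h (z * \<epsilon>)"
        unfolding set_integral_mult_right tail_integral_scale[OF that, where h = ?h] using that by simp
    qed
    have "tail_integral ?f \<epsilon> = tail_integral (\<lambda>t. x * ?h (x * t) - y * ?h (y * t)) \<epsilon>"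
      by (rule set_lebesgue_integral_cong) (use x y in \<open>auto simp: diff_divide_distrib\<close>)
    also have "\<dots> = tail_integral ?h (x * \<epsilon>) - tail_integral ?h (y * \<epsilon>)"
      using set_integral_diff(2)[OF s(1)[OF x] s(1)[OF y]] s(2)[OF x] s(2)[OF y] by simp
    finally show ?thesis
      using x y \<epsilon> by (simp add: ln_mult ln_div)
  qed
  have "((\<lambda>\<epsilon>. (tail_integral ?h (x * \<epsilon>) + ln (x * \<epsilon>))
      - (tail_integral ?h (y * \<epsilon>) + ln (y * \<epsilon>)) + ln (y / x)) \<longlongrightarrow> c - c + ln (y / x)) (at_right 0)"
    by (intro tendsto_intros c' x y)
  moreover have "\<forall>\<^sub>F \<epsilon> in at_right 0. (tail_integral ?h (x * \<epsilon>) + ln (x * \<epsilon>))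
      - (tail_integral ?h (y * \<epsilon>) + ln (y * \<epsilon>)) + ln (y / x) = tail_integral ?f \<epsilon>"
    using eventually_at_right_less[of 0] by eventually_elim (simp only: eq)
  ultimately have "(tail_integral ?f \<longlongrightarrow> c - c + ln (y / x)) (at_right 0)"
    by (rule Lim_transform_eventually)
  hence "(tail_integral ?f \<longlongrightarrow> ln (y / x)) (at_right 0)" by simp
  thus "tail_integral ?f 0 = ln (y / x)"
    using tail_integral_tendsto[OF int] tendsto_unique trivial_limit_at_right_real by blast
qed

section \<open>Binet's formula for the digamma function\<close>

lemma binet_integral:
  fixes x :: real
  assumes x: "x > 0"
  shows "set_integrable lborel {0<..} (\<lambda>t. binet_kernel t * exp (- (x * t)))"
    and "tail_integral (\<lambda>t. binet_kernel t * exp (- (x * t))) 0 \<in> {0..1 / (2 * x)}"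
proof -
  let ?f = "\<lambda>t. binet_kernel t * exp (- (x * t))"
  have e: "set_integrable lborel {0<..} (\<lambda>t. 1 / 2 * exp (- (x * t)))"
    using exp_tail_integral(1)[OF x] by simp
  have b: "0 \<le> ?f t" "?f t \<le> 1 / 2 * exp (- (x * t))" if "t > 0" for t
    using binet_kernel_nonneg[OF that] binet_kernel_le_half[OF that]
    by (auto intro!: mult_right_mono simp del: times_divide_eq_left)
  show int: "set_integrable lborel {0<..} ?f"
    by (rule set_integrable_dominated[OF e]) (use b in auto)
  have "tail_integral ?f 0 \<le> tail_integral (\<lambda>t. 1 / 2 * exp (- (x * t))) 0"
    by (rule set_integral_mono[OF int e]) (use b in auto)
  also have "\<dots> = 1 / (2 * x)"
    using exp_tail_integral(2)[OF x, of 0] by simp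
  finally have "tail_integral ?f 0 \<le> 1 / (2 * x)" .
  moreover have "tail_integral ?f 0 \<ge> 0"
    unfolding set_lebesgue_integral_def by (rule Bochner_Integration.integral_nonneg) (use b in \<open>auto simp: indicator_def\<close>)
  ultimately show "tail_integral ?f 0 \<in> {0..1 / (2 * x)}" by simp
qed

text \<open>
  Passing from \<open>x\<close> to \<open>x + 1\<close> multiplies the integrand by \<open>e^(-t)\<close>. In the difference, the factor
  \<open>1 - e^(-t)\<close> cancels the denominator of the kernel, and only exponentials and a Frullani integral
  are left.
\<close>

lemma binet_integral_step:
  fixes x :: real
  assumes x: "x > 0"
  defines "I \<equiv> \<lambda>x. tail_integral (\<lambda>t. binet_kernel t * exp (- (x * t))) 0"
  shows "I x - I (x + 1) = 1 / (2 * x) + 1 / (2 * (x + 1)) - ln ((x + 1) / x)"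
proof -
  have x1: "x + 1 > 0" using x by simp
  note F = frullani_exp[of x "x + 1"]
  note E = exp_tail_integral[OF x, of 0] exp_tail_integral[OF x1, of 0]
  have "I x - I (x + 1) = tail_integral (\<lambda>t. binet_kernel t * exp (- (x * t))
      - binet_kernel t * exp (- ((x + 1) * t))) 0"
    unfolding I_def using set_integral_diff(2)[OF binet_integral(1)[OF x] binet_integral(1)[OF x1]] by simp
  also have "\<dots> = tail_integral (\<lambda>t. (1 / 2 * exp (- (x * t)) + 1 / 2 * exp (- ((x + 1) * t)))
      - (exp (- (x * t)) - exp (- ((x + 1) * t))) / t) 0"
  proof (rule set_lebesgue_integral_cong, simp, intro allI impI)
    fix t :: real assume "t \<in> {0<..}"
    hence t: "0 < t" by simp
    define p q where "p = exp (- t)" and "q = exp (- (x * t))"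
    have "p \<noteq> 1" using t by (simp add: p_def)
    have q: "exp (- ((x + 1) * t)) = q * p"
      by (simp add: p_def q_def algebra_simps flip: exp_add)
    have "(1 / (1 - p) - 1 / t - 1 / 2) * q - (1 / (1 - p) - 1 / t - 1 / 2) * (q * p)
      = (1 / 2 * q + 1 / 2 * (q * p)) - (q - q * p) / t"
      using t \<open>p \<noteq> 1\<close> by (simp add: divide_simps) algebra
    thus "binet_kernel t * exp (- (x * t)) - binet_kernel t * exp (- ((x + 1) * t))
      = (1 / 2 * exp (- (x * t)) + 1 / 2 * exp (- ((x + 1) * t)))
      - (exp (- (x * t)) - exp (- ((x + 1) * t))) / t"
      unfolding q unfolding binet_kernel_def p_def[symmetric] q_def[symmetric] .
  qed
  also have "\<dots> = (tail_integral (\<lambda>t. 1 / 2 * exp (- (x * t))) 0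
      + tail_integral (\<lambda>t. 1 / 2 * exp (- ((x + 1) * t))) 0)
      - tail_integral (\<lambda>t. (exp (- (x * t)) - exp (- ((x + 1) * t))) / t) 0"
    by (subst set_integral_diff(2), (intro set_integral_add(1) set_integrable_mult_right E F(1); use x in simp)+,
        subst set_integral_add(2), (intro set_integrable_mult_right E; simp)+, simp)
  also have "\<dots> = 1 / (2 * x) + 1 / (2 * (x + 1)) - ln ((x + 1) / x)"
    using x F(2) E by (simp add: algebra_simps)
  finally show ?thesis .
qed

text \<open>
  Summing the one-step differences telescopes to the partial sums in the limit formula for the
  digamma function. The remaining integral at \<open>x + m\<close> is at most \<open>1 / (2 (x + m))\<close>.
\<close>

lemma Digamma_binet:
  fixes x :: real
  assumes x: "x > 0"
  shows "Digamma x + 1 / (2 * x) - ln x = - tail_integral (\<lambda>t. binet_kernel t * exp (- (x * t))) 0"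
proof -
  define I where "I = (\<lambda>x. tail_integral (\<lambda>t. binet_kernel t * exp (- (x * t))) 0)"
  have sum: "(\<Sum>n<m. inverse (x + real n)) = I x - I (x + real m) + ln (x + real m) - ln x
      + 1 / (2 * x) - 1 / (2 * (x + real m))" for m
  proof (induction m)
    case (Suc m)
    have "I (x + real m) - I (x + real m + 1) = 1 / (2 * (x + real m)) + 1 / (2 * (x + real m + 1))
        - ln ((x + real m + 1) / (x + real m))"
      unfolding I_def by (rule binet_integral_step) (use x in simp)
    moreover have "ln ((x + real m + 1) / (x + real m)) = ln (x + real m + 1) - ln (x + real m)"
      using x by (intro ln_divide_pos) auto
    moreover have "inverse (x + real m) = 1 / (2 * (x + real m)) + 1 / (2 * (x + real m))"
      using x by (simp add: field_simps)
    moreover have Suc': "x + real (Suc m) = x + real m + 1" by simp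
    ultimately show ?case using Suc.IH unfolding sum.lessThan_Suc Suc' by linarith
  qed simp
  have I0: "(\<lambda>m. I (x + real m)) \<longlonglongrightarrow> 0"
  proof (rule tendsto_sandwich[of "\<lambda>_. 0" _ _ "\<lambda>m. 1 / (2 * (x + real m))"])
    show "(\<lambda>m. 1 / (2 * (x + real m))) \<longlonglongrightarrow> 0" by real_asymp
    have "I (x + real m) \<in> {0..1 / (2 * (x + real m))}" for m
      unfolding I_def by (rule binet_integral(2)) (use x in simp)
    thus "\<forall>\<^sub>F m in sequentially. 0 \<le> I (x + real m)"
      "\<forall>\<^sub>F m in sequentially. I (x + real m) \<le> 1 / (2 * (x + real m))" by auto
  qed simp
  have "(\<lambda>m. (ln (real m) - ln (x + real m) + 1 / (2 * (x + real m))) + I (x + real m)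
      - I x + ln x - 1 / (2 * x)) \<longlonglongrightarrow> 0 + 0 - I x + ln x - 1 / (2 * x)"
  proof (intro tendsto_intros I0)
    show "(\<lambda>m. ln (real m) - ln (x + real m) + 1 / (2 * (x + real m))) \<longlonglongrightarrow> 0"
      by real_asymp
  qed
  moreover have "(\<lambda>m. ln (real m) - (\<Sum>n<m. inverse (x + real n))) \<longlonglongrightarrow> Digamma x"
    using Digamma_LIMSEQ[of x] x by simp
  ultimately have "Digamma x = 0 + 0 - I x + ln x - 1 / (2 * x)"
    unfolding sum by (intro LIMSEQ_unique) (simp_all add: algebra_simps)
  thus ?thesis by (simp add: I_def)
qed

section \<open>The function F1 as an integral\<close>

definition herglotz_kernel_integral :: "real \<Rightarrow> real" where
  "herglotz_kernel_integral x = tail_integral (\<lambda>t. binet_kernel t * bose (x * t)) 0"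

text \<open>
  The linear bound on the kernel compensates the simple pole of \<open>bose\<close> at 0.
\<close>

lemma herglotz_kernel_integrable:
  assumes x: "x > 0"
  shows "set_integrable lborel {0<..} (\<lambda>t. binet_kernel t * bose (x * t))"
proof (rule set_integrable_dominated)
  show "set_integrable lborel {0<..} (\<lambda>t. 1 / x * exp (- (x / 2 * t)))"
    using exp_tail_integral(1)[of "x / 2" 0] x by simp
  fix t :: real assume t: "t > 0"
  have "binet_kernel t * bose (x * t) \<le> t / 2 * (2 / (x * t) * exp (- (x * t) / 2))"
    using bose_bound[of "x * t"] binet_kernel_le_linear[OF t] binet_kernel_nonneg[OF t] t x
    by (intro mult_mono) auto
  also have "\<dots> = 1 / x * exp (- (x / 2 * t))"
    using t x by simp
  finally have "binet_kernel t * bose (x * t) \<le> 1 / x * exp (- (x / 2 * t))" .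
  moreover have "binet_kernel t * bose (x * t) \<ge> 0"
    using bose_bound(1)[of "x * t"] binet_kernel_nonneg[OF t] t x by simp
  ultimately show "\<bar>binet_kernel t * bose (x * t)\<bar> \<le> 1 / x * exp (- (x / 2 * t))" by simp
qed measurable

lemma bose_geometric_sums:
  assumes "t > 0"
  shows "(\<lambda>k. exp (- (real (Suc k) * t))) sums bose t"
proof -
  have "(\<lambda>k. exp (- t) * exp (- t) ^ k) sums (exp (- t) * (1 / (1 - exp (- t))))"
    using assms by (intro sums_mult geometric_sums) auto
  moreover have "exp (- t) * exp (- t) ^ k = exp (- (real (Suc k) * t))" for k
    by (simp add: algebra_simps flip: exp_add exp_of_nat_mult)
  moreover have "exp (- t) * (1 / (1 - exp (- t))) = bose t"
    using assms by (simp add: bose_def exp_minus field_simps)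
  ultimately show ?thesis by simp
qed

text \<open>
  Binet's formula at \<open>j x\<close>, summed over \<open>j \<ge> 1\<close> under the integral. The kernel is nonnegative,
  so the limit dominates all partial sums.
\<close>

lemma herglotz_kernel_sums:
  assumes x: "x > 0"
  shows "(\<lambda>k. Digamma (real (Suc k) * x) + 1 / (2 * (real (Suc k) * x)) - ln (real (Suc k) * x))
           sums (- herglotz_kernel_integral x)"
proof -
  let ?f = "\<lambda>k t. binet_kernel t * exp (- (real (Suc k) * x * t))"
  let ?F = "\<lambda>N t. \<Sum>k<N. ?f k t"
  let ?g = "\<lambda>t. binet_kernel t * bose (x * t)"
  have f_int: "set_integrable lborel {0<..} (?f k)" for k
    by (rule binet_integral(1)) (use x in simp)
  have geo: "(\<lambda>k. ?f k t) sums ?g t" if "t > 0" for t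
    using sums_mult[OF bose_geometric_sums[of "x * t"], of "binet_kernel t"] x that
    by (simp add: mult.assoc)
  have "(\<lambda>N. tail_integral (?F N) 0) \<longlonglongrightarrow> tail_integral ?g 0"
    unfolding set_lebesgue_integral_def
  proof (rule integral_dominated_convergence[where w = "\<lambda>t. indicator {0<..} t *\<^sub>R ?g t"])
    show "integrable lborel (\<lambda>t. indicator {0<..} t *\<^sub>R ?g t)"
      using herglotz_kernel_integrable[OF x] by (simp add: set_integrable_def)
    show "AE t in lborel. (\<lambda>N. indicator {0<..} t *\<^sub>R ?F N t) \<longlonglongrightarrow> indicator {0<..} t *\<^sub>R ?g t"
      using geo by (intro AE_I2) (auto simp: indicator_def sums_def)
    show "AE t in lborel. norm (indicator {0<..} t *\<^sub>R ?F N t) \<le> indicator {0<..} t *\<^sub>R ?g t" for N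
    proof (intro AE_I2)
      fix t :: real
      show "norm (indicator {0<..} t *\<^sub>R ?F N t) \<le> indicator {0<..} t *\<^sub>R ?g t"
      proof (cases "t > 0")
        case True
        hence nonneg: "?f k t \<ge> 0" for k using binet_kernel_nonneg[OF True] by simp
        have "?F N t \<le> (\<Sum>k. ?f k t)"
          using geo[OF True] nonneg by (intro sum_le_suminf) (auto simp: sums_iff)
        also have "\<dots> = ?g t" using geo[OF True] by (simp add: sums_iff)
        finally show ?thesis using True sum_nonneg[of "{..<N}" "\<lambda>k. ?f k t"] nonneg by simp
      qed simp
    qed
  qed measurable
  moreover have "tail_integral (?F N) 0 = (\<Sum>k<N. tail_integral (?f k) 0)" for N
    using f_int unfolding set_lebesgue_integral_def set_integrable_def scaleR_sum_right
    by (intro Bochner_Integration.integral_sum) auto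
  moreover have "tail_integral (?f k) 0
      = - (Digamma (real (Suc k) * x) + 1 / (2 * (real (Suc k) * x)) - ln (real (Suc k) * x))" for k
    using Digamma_binet[of "real (Suc k) * x"] x by simp
  ultimately have "(\<lambda>k. - (Digamma (real (Suc k) * x) + 1 / (2 * (real (Suc k) * x)) - ln (real (Suc k) * x)))
      sums herglotz_kernel_integral x"
    by (simp only: sums_def herglotz_kernel_integral_def)
  from sums_minus[OF this] show ?thesis by simp
qed

lemma herglotz_F1_of_real:
  assumes x: "x > 0"
  shows "herglotz_F1 (of_real x)
    = of_real (- herglotz_kernel_integral x - 1 / 2 * (euler_mascheroni - ln (2 * pi / x)))"
proof -
  have summand: "Digamma (of_nat (Suc k) * of_real x) + 1 / (2 * of_nat (Suc k) * of_real x)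
      - ln (of_nat (Suc k) * of_real x)
    = complex_of_real (Digamma (real (Suc k) * x) + 1 / (2 * (real (Suc k) * x)) - ln (real (Suc k) * x))" for k
  proof -
    define y where "y = real (Suc k) * x"
    have y: "y > 0" using x by (simp add: y_def)
    have e: "of_nat (Suc k) * complex_of_real x = of_real y" by (simp add: y_def)
    have "Digamma (complex_of_real y) = of_real (Digamma y)" "ln (complex_of_real y) = of_real (ln y)"
      using y by (auto intro: Polygamma_of_real Ln_of_real)
    thus ?thesis
      unfolding mult.assoc e y_def[symmetric] by simp
  qed
  have "(\<Sum>k. Digamma (of_nat (Suc k) * of_real x) + 1 / (2 * of_nat (Suc k) * of_real x)
      - ln (of_nat (Suc k) * of_real x)) = complex_of_real (- herglotz_kernel_integral x)"
    unfolding summand using sums_of_real[OF herglotz_kernel_sums[OF x], where 'a = complex]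
    by (simp only: sums_iff)
  moreover have "ln (2 * of_real pi / complex_of_real x) = of_real (ln (2 * pi / x))"
    using x Ln_of_real[of "2 * pi / x"] by simp
  ultimately show ?thesis
    unfolding herglotz_F1_def by simp
qed

section \<open>The two divergent integrals\<close>

lemma bose_over_t_integrable:
  assumes "a > 0"
  shows "set_integrable lborel {a<..} (\<lambda>t. bose t / t)"
proof (rule set_integrable_dominated)
  show "set_integrable lborel {a<..} (\<lambda>t. 1 / a * bose t)"
    using bose_tail_integral(1)[OF assms] by simp
  fix t assume "t > a"
  thus "\<bar>bose t / t\<bar> \<le> 1 / a * bose t"
    using assms bose_bound(1)[of t] by (simp add: field_simps)
qed measurable

lemma bose_over_t_asymptotics:
  "\<exists>c. ((\<lambda>\<epsilon>. tail_integral (\<lambda>t. bose t / t) \<epsilon> - 1 / \<epsilon> - ln \<epsilon> / 2) \<longlongrightarrow> c) (at_right 0)"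
proof -
  have "\<exists>c. ((\<lambda>\<epsilon>. tail_integral (\<lambda>t. bose t / t) \<epsilon> - 1 / \<epsilon> + (- 1 / 2) * ln \<epsilon>) \<longlongrightarrow> c) (at_right 0)"
  proof (rule tail_integral_asymptotics)
    show "set_integrable lborel {1<..} (\<lambda>t. bose t / t)"
      by (rule bose_over_t_integrable) simp
    fix t :: real assume t: "0 < t" "t \<le> 1"
    have "bose t / t - 1 / t\<^sup>2 - (- 1 / 2) / t = binet_kernel t / t"
      using t by (simp add: binet_kernel_eq_bose field_simps power2_eq_square)
    moreover have "0 \<le> binet_kernel t / t" "binet_kernel t / t \<le> 1 / 2"
      using t binet_kernel_nonneg[of t] binet_kernel_le_linear[of t] by (auto simp: field_simps)
    ultimately show "\<bar>bose t / t - 1 / t\<^sup>2 - (- 1 / 2) / t\<bar> \<le> 1 / 2" by simp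
  qed measurable
  thus ?thesis by simp
qed

lemma bose_tail_asymptotics:
  "((\<lambda>\<epsilon>. tail_integral bose \<epsilon> + ln \<epsilon>) \<longlongrightarrow> 0) (at_right 0)"
proof -
  have "((\<lambda>\<epsilon>::real. - ln (1 - exp (- \<epsilon>)) + ln \<epsilon>) \<longlongrightarrow> 0) (at_right 0)"
    by real_asymp
  moreover have "\<forall>\<^sub>F \<epsilon> in at_right 0. - ln (1 - exp (- \<epsilon>)) + ln \<epsilon> = tail_integral bose \<epsilon> + ln \<epsilon>"
    using eventually_at_right_less[of 0] by eventually_elim (simp add: bose_tail_integral(2))
  ultimately show ?thesis by (rule Lim_transform_eventually)
qed

section \<open>The inversion formula\<close>

lemma tendsto_mult_at_right_0:
  fixes f :: "real \<Rightarrow> real"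
  assumes "(f \<longlongrightarrow> l) (at_right 0)" "z > 0"
  shows "((\<lambda>\<epsilon>. f (z * \<epsilon>)) \<longlongrightarrow> l) (at_right 0)"
  by (rule filterlim_compose[OF assms(1)]) (use assms(2) in real_asymp)

text \<open>
  Away from 0 the product can be expanded, and this produces the two divergent tails.
\<close>

lemma bose_product_tail_integral:
  assumes x: "x > 0" and \<epsilon>: "\<epsilon> > 0"
  shows "set_integrable lborel {\<epsilon><..} (\<lambda>t. (1 + bose t) * bose (x * t))"
    and "tail_integral (\<lambda>t. (1 + bose t) * bose (x * t)) \<epsilon>
      = tail_integral (\<lambda>t. binet_kernel t * bose (x * t)) \<epsilon>
        + tail_integral (\<lambda>t. bose t / t) (x * \<epsilon>) + tail_integral bose (x * \<epsilon>) / (2 * x)"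
proof -
  let ?h = "\<lambda>t. bose t / t"
  have A: "set_integrable lborel {\<epsilon><..} (\<lambda>t. binet_kernel t * bose (x * t))"
    by (rule set_integrable_subset[OF herglotz_kernel_integrable[OF x]]) (use \<epsilon> in auto)
  have "set_integrable lborel {\<epsilon><..} (\<lambda>t. ?h (x * t))"
    by (rule set_integrable_scale[OF x bose_over_t_integrable]) (use x \<epsilon> in simp)
  hence H: "set_integrable lborel {\<epsilon><..} (\<lambda>t. x * ?h (x * t))"
    by (rule set_integrable_mult_right)
  have "set_integrable lborel {\<epsilon><..} (\<lambda>t. bose (x * t))"
    by (rule set_integrable_scale[OF x bose_tail_integral(1)]) (use x \<epsilon> in simp)
  hence G: "set_integrable lborel {\<epsilon><..} (\<lambda>t. 1 / 2 * bose (x * t))"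
    by (rule set_integrable_mult_right)
  have split: "(1 + bose t) * bose (x * t)
      = binet_kernel t * bose (x * t) + x * ?h (x * t) + 1 / 2 * bose (x * t)" if "t \<in> {\<epsilon><..}" for t
    using that \<epsilon> x by (simp add: binet_kernel_eq_bose field_simps)
  have "set_integrable lborel {\<epsilon><..}
      (\<lambda>t. binet_kernel t * bose (x * t) + x * ?h (x * t) + 1 / 2 * bose (x * t))"
    by (intro set_integral_add A H G)
  also have "?this \<longleftrightarrow> set_integrable lborel {\<epsilon><..} (\<lambda>t. (1 + bose t) * bose (x * t))"
    by (rule set_integrable_cong) (use split in auto)
  finally show "set_integrable lborel {\<epsilon><..} (\<lambda>t. (1 + bose t) * bose (x * t))" .
  have "tail_integral (\<lambda>t. (1 + bose t) * bose (x * t)) \<epsilon>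
    = tail_integral (\<lambda>t. binet_kernel t * bose (x * t) + x * ?h (x * t) + 1 / 2 * bose (x * t)) \<epsilon>"
    by (rule set_lebesgue_integral_cong) (use split in auto)
  also have "\<dots> = tail_integral (\<lambda>t. binet_kernel t * bose (x * t)) \<epsilon>
      + tail_integral (\<lambda>t. x * ?h (x * t)) \<epsilon> + tail_integral (\<lambda>t. 1 / 2 * bose (x * t)) \<epsilon>"
    unfolding set_integral_add(2)[OF set_integral_add(1)[OF A H] G] set_integral_add(2)[OF A H] ..
  also have "tail_integral (\<lambda>t. x * ?h (x * t)) \<epsilon> = tail_integral ?h (x * \<epsilon>)"
    unfolding set_integral_mult_right tail_integral_scale[OF x, where h = ?h] using x by simp
  also have "tail_integral (\<lambda>t. 1 / 2 * bose (x * t)) \<epsilon> = tail_integral bose (x * \<epsilon>) / (2 * x)"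
    unfolding set_integral_mult_right tail_integral_scale[OF x, where h = bose] by simp
  finally show "tail_integral (\<lambda>t. (1 + bose t) * bose (x * t)) \<epsilon>
      = tail_integral (\<lambda>t. binet_kernel t * bose (x * t)) \<epsilon>
        + tail_integral ?h (x * \<epsilon>) + tail_integral bose (x * \<epsilon>) / (2 * x)" .
qed

lemma bose_product_rescale:
  assumes z: "z > 0" and \<epsilon>: "\<epsilon> > 0" and y: "y > 0"
  shows "set_integrable lborel {\<epsilon><..} (\<lambda>t. (1 + bose (z * t)) * bose (y * t))"
    and "tail_integral (\<lambda>t. (1 + bose (z * t)) * bose (y * t)) \<epsilon>
      = tail_integral (\<lambda>t. (1 + bose t) * bose (y / z * t)) (z * \<epsilon>) / z"
proof -
  let ?h = "\<lambda>t. (1 + bose t) * bose (y / z * t)"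
  have h: "?h (z * t) = (1 + bose (z * t)) * bose (y * t)" for t
    using z by simp
  have "set_integrable lborel {\<epsilon><..} (\<lambda>t. ?h (z * t))"
    by (rule set_integrable_scale[OF z bose_product_tail_integral(1)]) (use z y \<epsilon> in simp_all)
  thus "set_integrable lborel {\<epsilon><..} (\<lambda>t. (1 + bose (z * t)) * bose (y * t))"
    unfolding h .
  show "tail_integral (\<lambda>t. (1 + bose (z * t)) * bose (y * t)) \<epsilon> = tail_integral ?h (z * \<epsilon>) / z"
    using tail_integral_scale[OF z, where h = ?h] unfolding h .
qed

lemma herglotz_kernel_tendsto:
  assumes "x > 0" "z > 0"
  shows "((\<lambda>\<epsilon>. tail_integral (\<lambda>t. binet_kernel t * bose (x * t)) (z * \<epsilon>))
    \<longlongrightarrow> herglotz_kernel_integral x) (at_right 0)"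
  unfolding herglotz_kernel_integral_def
  by (intro tendsto_mult_at_right_0 tail_integral_tendsto herglotz_kernel_integrable assms)

text \<open>
  Substituting \<open>t \<rightarrow> x t\<close> in \<open>A(1/x) / x\<close> turns the unregularised integrand \<open>(1 + bose t) * bose (t/x)\<close>
  into \<open>(1 + bose (x t)) * bose t\<close>, which differs from \<open>(1 + bose t) * bose (x t)\<close>
  only by bare Bose functions. Hence the truncated left-hand side consists of divergent tails
  alone. Their polar parts cancel, and the logarithms and \<open>c\<close> remain.
\<close>

lemma herglotz_kernel_inversion:
  assumes c: "((\<lambda>\<epsilon>. tail_integral (\<lambda>t. bose t / t) \<epsilon> - 1 / \<epsilon> - ln \<epsilon> / 2) \<longlongrightarrow> c) (at_right 0)"
    and x: "x > 0"
  shows "herglotz_kernel_integral x - herglotz_kernel_integral (1 / x) / x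
    = c * (1 / x - 1) - ln x / 2 * (1 + 1 / x)"
proof -
  define A where "A x \<epsilon> = tail_integral (\<lambda>t. binet_kernel t * bose (x * t)) \<epsilon>" for x \<epsilon>
  define G where "G \<epsilon> = tail_integral bose \<epsilon> + ln \<epsilon>" for \<epsilon>
  define H where "H \<epsilon> = tail_integral (\<lambda>t. bose t / t) \<epsilon> - 1 / \<epsilon> - ln \<epsilon> / 2" for \<epsilon>
  have H_lim: "((\<lambda>\<epsilon>. H (z * \<epsilon>)) \<longlongrightarrow> c) (at_right 0)" if "z > 0" for z
    using tendsto_mult_at_right_0[OF c that] by (simp only: H_def)
  have G_lim: "((\<lambda>\<epsilon>. G (z * \<epsilon>)) \<longlongrightarrow> 0) (at_right 0)" if "z > 0" for z
    using tendsto_mult_at_right_0[OF bose_tail_asymptotics that] by (simp only: G_def)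
  have A_lim: "((\<lambda>\<epsilon>. A y (z * \<epsilon>)) \<longlongrightarrow> herglotz_kernel_integral y) (at_right 0)" if "y > 0" "z > 0" for y z
    using herglotz_kernel_tendsto[OF that] by (simp only: A_def)
  \<comment> \<open>The cutoff for the inverted argument is \<open>x * \<epsilon>\<close>, so that both tails run over \<open>{\<epsilon><..}\<close>
      after the substitution.\<close>
  have eq: "G (x * \<epsilon>) / (2 * x) - G (1 * \<epsilon>) / 2 - H (x * \<epsilon>) + H (1 * \<epsilon>) / x - ln x / 2 * (1 + 1 / x)
      = A x (1 * \<epsilon>) - A (1 / x) (x * \<epsilon>) / x" if \<epsilon>: "\<epsilon> > 0" for \<epsilon>
  proof -
    have x\<epsilon>: "x * \<epsilon> > 0" and x': "1 / x > 0" using x \<epsilon> by auto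
    note P = bose_product_tail_integral[OF x \<epsilon>]
    note R = bose_product_rescale[OF x \<epsilon>, of 1]
    note B = set_integrable_scale[OF x bose_tail_integral(1)[OF x\<epsilon>]]
    have "tail_integral (\<lambda>t. (1 + bose t) * bose (x * t)) \<epsilon>
        - tail_integral (\<lambda>t. (1 + bose (x * t)) * bose (1 * t)) \<epsilon>
      = tail_integral (\<lambda>t. (1 + bose t) * bose (x * t) - (1 + bose (x * t)) * bose (1 * t)) \<epsilon>"
      using set_integral_diff(2)[OF P(1) R(1)] by simp
    also have "\<dots> = tail_integral (\<lambda>t. bose (x * t) - bose t) \<epsilon>"
      by (simp add: algebra_simps)
    also have "\<dots> = tail_integral (\<lambda>t. bose (x * t)) \<epsilon> - tail_integral bose \<epsilon>"
      by (rule set_integral_diff(2)[OF B bose_tail_integral(1)[OF \<epsilon>]])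
    also have "tail_integral (\<lambda>t. bose (x * t)) \<epsilon> = tail_integral bose (x * \<epsilon>) / x"
      by (rule tail_integral_scale[OF x])
    finally have D: "tail_integral (\<lambda>t. (1 + bose t) * bose (x * t)) \<epsilon>
        - tail_integral (\<lambda>t. (1 + bose (x * t)) * bose (1 * t)) \<epsilon>
        = tail_integral bose (x * \<epsilon>) / x - tail_integral bose \<epsilon>" .
    have "tail_integral (\<lambda>t. (1 + bose (x * t)) * bose (1 * t)) \<epsilon>
        = (A (1 / x) (x * \<epsilon>) + tail_integral (\<lambda>t. bose t / t) \<epsilon> + tail_integral bose \<epsilon> * x / 2) / x"
      unfolding R(2)[OF zero_less_one] bose_product_tail_integral(2)[OF x' x\<epsilon>] A_def using x by simp
    also have "\<dots> = A (1 / x) (x * \<epsilon>) / x + tail_integral (\<lambda>t. bose t / t) \<epsilon> / x + tail_integral bose \<epsilon> / 2"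
      using x by (simp add: add_divide_distrib)
    finally have Q: "tail_integral (\<lambda>t. (1 + bose (x * t)) * bose (1 * t)) \<epsilon> = \<dots>" .
    have "tail_integral bose (x * \<epsilon>) / x = tail_integral bose (x * \<epsilon>) / (2 * x) + tail_integral bose (x * \<epsilon>) / (2 * x)"
      by simp
    hence "A x \<epsilon> - A (1 / x) (x * \<epsilon>) / x
      = tail_integral bose (x * \<epsilon>) / (2 * x) - tail_integral bose \<epsilon> / 2
        - tail_integral (\<lambda>t. bose t / t) (x * \<epsilon>) + tail_integral (\<lambda>t. bose t / t) \<epsilon> / x"
      using D unfolding Q P(2) A_def[symmetric] by linarith
    moreover have "ln (x * \<epsilon>) = ln x + ln \<epsilon>" using x \<epsilon> by (simp add: ln_mult)
    ultimately show ?thesis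
      by (simp add: G_def H_def ring_distribs add_divide_distrib diff_divide_distrib mult.commute)
  qed
  have "((\<lambda>\<epsilon>. G (x * \<epsilon>) / (2 * x) - G (1 * \<epsilon>) / 2 - H (x * \<epsilon>) + H (1 * \<epsilon>) / x - ln x / 2 * (1 + 1 / x))
      \<longlongrightarrow> 0 / (2 * x) - 0 / 2 - c + c / x - ln x / 2 * (1 + 1 / x)) (at_right 0)"
    by (intro tendsto_intros H_lim G_lim) (use x in auto)
  moreover have "\<forall>\<^sub>F \<epsilon> in at_right 0.
      G (x * \<epsilon>) / (2 * x) - G (1 * \<epsilon>) / 2 - H (x * \<epsilon>) + H (1 * \<epsilon>) / x - ln x / 2 * (1 + 1 / x)
      = A x (1 * \<epsilon>) - A (1 / x) (x * \<epsilon>) / x"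
    using eventually_at_right_less[of 0] by eventually_elim (rule eq)
  ultimately have "((\<lambda>\<epsilon>. A x (1 * \<epsilon>) - A (1 / x) (x * \<epsilon>) / x)
      \<longlongrightarrow> 0 / (2 * x) - 0 / 2 - c + c / x - ln x / 2 * (1 + 1 / x)) (at_right 0)"
    by (rule Lim_transform_eventually)
  moreover have "((\<lambda>\<epsilon>. A x (1 * \<epsilon>) - A (1 / x) (x * \<epsilon>) / x)
      \<longlongrightarrow> herglotz_kernel_integral x - herglotz_kernel_integral (1 / x) / x) (at_right 0)"
    by (intro tendsto_intros A_lim) (use x in auto)
  ultimately have "0 / (2 * x) - 0 / 2 - c + c / x - ln x / 2 * (1 + 1 / x)
      = herglotz_kernel_integral x - herglotz_kernel_integral (1 / x) / x"
    by (rule tendsto_unique[OF trivial_limit_at_right_real])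
  thus ?thesis by (simp add: algebra_simps)
qed

section \<open>Splitting the lattice sum by parity\<close>

text \<open>
  This is the splitting of the double sum with signs. With \<open>p = e^(-t)\<close> and \<open>q = e^(-ut)\<close>, the
  left-hand side is minus the sum of \<open>(-1)^(i + j) p^i q^j\<close> over \<open>i \<ge> 0\<close>, \<open>j \<ge> 1\<close>. The pairs with
  \<open>i - j = 2k \<ge> 0\<close> contribute \<open>p^(2k) (pq)^j\<close>, those with \<open>j - i = 2k \<ge> 0\<close> and \<open>i \<ge> 1\<close> contribute
  \<open>q^(2k) (pq)^i\<close>. The last two terms correct for the diagonal, which is counted twice, and
  for the axis \<open>i = 0\<close>, which is missed.
\<close>

lemma parity_integrand_decomposition:
  fixes u t :: real
  assumes u: "u > 0" and t: "t > 0"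
  shows "1 / ((1 + exp (- t)) * (1 + exp (u * t)))
    = (1 + bose (1 * t)) * bose (u * t) - 2 * ((1 + bose (2 * t)) * bose ((u + 1) * t))
      - 2 * ((1 + bose (2 * u * t)) * bose ((u + 1) * t)) + (2 * bose ((u + 1) * t) - 2 * bose (2 * u * t))"
proof -
  define P Q where "P = exp t" and "Q = exp (u * t)"
  have P: "P > 1" and Q: "Q > 1" using u t by (auto simp: P_def Q_def)
  have e: "exp (1 * t) = P" "exp (2 * t) = P * P" "exp ((u + 1) * t) = P * Q" "exp (2 * u * t) = Q * Q"
    "exp (u * t) = Q" "exp (- t) = 1 / P"
    by (simp_all add: P_def Q_def exp_minus field_simps flip: exp_add)
  have PQ: "P * Q > 1"
    using P Q by (rule less_1_mult)
  have nz: "P - 1 \<noteq> 0" "Q - 1 \<noteq> 0" "P * Q - 1 \<noteq> 0" "P \<noteq> 0" "1 + P \<noteq> 0" "1 + Q \<noteq> 0"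
    using P Q PQ by auto
  have f1: "1 / (P * P - 1) = 1 / ((P - 1) * (1 + P))" "1 / (Q * Q - 1) = 1 / ((Q - 1) * (1 + Q))"
    by (simp_all add: algebra_simps)
  have "P / ((1 + P) * (1 + Q)) = (1 + 1 / (P - 1)) * (1 / (Q - 1))
    - 2 * ((1 + 1 / ((P - 1) * (1 + P))) * (1 / (P * Q - 1)))
    - 2 * ((1 + 1 / ((Q - 1) * (1 + Q))) * (1 / (P * Q - 1))) + (2 * (1 / (P * Q - 1)) - 2 * (1 / ((Q - 1) * (1 + Q))))"
    using nz by (simp add: divide_simps) algebra
  moreover have "1 / ((1 + 1 / P) * (1 + Q)) = P / ((1 + P) * (1 + Q))"
    using nz by (simp add: field_simps)
  ultimately show ?thesis unfolding bose_def e f1 by simp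
qed

text \<open>
  The first three products of the pointwise decomposition are the unregularised integrands of
  \<open>A\<close> at \<open>u\<close>, \<open>(u + 1) / 2\<close> and \<open>(u + 1) / (2u)\<close>, the last two after \<open>t \<rightarrow> 2t\<close> and \<open>t \<rightarrow> 2ut\<close>.
  As \<open>J\<^sub>1\<close> converges, the divergent tails must cancel. They leave \<open>- c / u\<close> and the logarithms.
\<close>

lemma parity_integral_decomposition:
  assumes c: "((\<lambda>\<epsilon>. tail_integral (\<lambda>t. bose t / t) \<epsilon> - 1 / \<epsilon> - ln \<epsilon> / 2) \<longlongrightarrow> c) (at_right 0)"
    and u: "u > 0"
  shows "tail_integral (\<lambda>t. 1 / ((1 + exp (- t)) * (1 + exp (u * t)))) 0
    = herglotz_kernel_integral u - herglotz_kernel_integral ((u + 1) / 2)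
      - herglotz_kernel_integral ((u + 1) / (2 * u)) / u
      - c / u + (ln u - ln (u + 1)) / 2 * (1 + 1 / u) + ln 2 / u"
proof -
  define A where "A x \<epsilon> = tail_integral (\<lambda>t. binet_kernel t * bose (x * t)) \<epsilon>" for x \<epsilon>
  define G where "G \<epsilon> = tail_integral bose \<epsilon> + ln \<epsilon>" for \<epsilon>
  define H where "H \<epsilon> = tail_integral (\<lambda>t. bose t / t) \<epsilon> - 1 / \<epsilon> - ln \<epsilon> / 2" for \<epsilon>
  define K where "K t = 1 / ((1 + exp (- t)) * (1 + exp (u * t)))" for t
  \<comment> \<open>\<open>G\<close> and \<open>H\<close> are the divergent tails without their singular parts. \<open>R\<close> is the truncated
      right-hand side in terms of them, and \<open>?E\<close> is what the singular parts sum to.\<close>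
  define R where "R \<epsilon> = A u (1 * \<epsilon>) - A ((u + 1) / 2) (2 * \<epsilon>) - A ((u + 1) / (2 * u)) (2 * u * \<epsilon>) / u
      + H (u * \<epsilon>) - (1 + 1 / u) * H ((u + 1) * \<epsilon>) + G (u * \<epsilon>) / (2 * u) - G (2 * u * \<epsilon>) / u" for \<epsilon>
  let ?E = "(ln u - ln (u + 1)) / 2 * (1 + 1 / u) + ln 2 / u"
  have H_lim: "((\<lambda>\<epsilon>. H (z * \<epsilon>)) \<longlongrightarrow> c) (at_right 0)" if "z > 0" for z
    using tendsto_mult_at_right_0[OF c that] by (simp only: H_def)
  have G_lim: "((\<lambda>\<epsilon>. G (z * \<epsilon>)) \<longlongrightarrow> 0) (at_right 0)" if "z > 0" for z
    using tendsto_mult_at_right_0[OF bose_tail_asymptotics that] by (simp only: G_def)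
  have A_lim: "((\<lambda>\<epsilon>. A y (z * \<epsilon>)) \<longlongrightarrow> herglotz_kernel_integral y) (at_right 0)" if "y > 0" "z > 0" for y z
    using herglotz_kernel_tendsto[OF that] by (simp only: A_def)
  have K_int: "set_integrable lborel {0<..} K"
  proof (rule set_integrable_dominated[OF exp_tail_integral(1)[OF u, of 0]])
    show "K \<in> borel_measurable borel" unfolding K_def by measurable
    fix t :: real assume "t > 0"
    have "exp (u * t) \<le> (1 + exp (- t)) * (1 + exp (u * t))"
      using mult_mono[of 1 "1 + exp (- t)" "exp (u * t)" "1 + exp (u * t)"] by simp
    hence "K t \<le> 1 / exp (u * t)"
      unfolding K_def by (intro divide_left_mono) (auto intro!: mult_pos_pos add_pos_pos)
    moreover have "K t \<ge> 0" by (simp add: K_def add_nonneg_nonneg)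
    ultimately show "\<bar>K t\<bar> \<le> exp (- (u * t))" by (simp add: exp_minus field_simps)
  qed
  have eq: "R \<epsilon> + ?E = tail_integral K \<epsilon>" if \<epsilon>: "\<epsilon> > 0" for \<epsilon>
  proof -
    have pos: "u + 1 > 0" "2 * u > 0" "2 * \<epsilon> > 0" "2 * u * \<epsilon> > 0" "(u + 1) * \<epsilon> > 0"
      "(u + 1) / 2 > 0" "(u + 1) / (2 * u) > 0"
      using u \<epsilon> by auto
    have I1: "set_integrable lborel {\<epsilon><..} (\<lambda>t. (1 + bose (1 * t)) * bose (u * t))"
      using bose_product_tail_integral(1)[OF u \<epsilon>] by simp
    have I2: "set_integrable lborel {\<epsilon><..} (\<lambda>t. 2 * ((1 + bose (2 * t)) * bose ((u + 1) * t)))"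
      by (intro set_integrable_mult_right bose_product_rescale(1)) (use pos \<epsilon> in auto)
    have I3: "set_integrable lborel {\<epsilon><..} (\<lambda>t. 2 * ((1 + bose (2 * u * t)) * bose ((u + 1) * t)))"
      by (intro set_integrable_mult_right bose_product_rescale(1)) (use pos \<epsilon> in auto)
    have I4: "set_integrable lborel {\<epsilon><..} (\<lambda>t. 2 * bose ((u + 1) * t))"
      by (intro set_integrable_mult_right set_integrable_scale bose_tail_integral(1)) (use pos in auto)
    have I5: "set_integrable lborel {\<epsilon><..} (\<lambda>t. 2 * bose (2 * u * t))"
      by (intro set_integrable_mult_right set_integrable_scale bose_tail_integral(1)) (use pos in auto)
    have V1: "tail_integral (\<lambda>t. (1 + bose (1 * t)) * bose (u * t)) \<epsilon>
      = A u \<epsilon> + tail_integral (\<lambda>t. bose t / t) (u * \<epsilon>) + tail_integral bose (u * \<epsilon>) / (2 * u)"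
      using bose_product_tail_integral(2)[OF u \<epsilon>] by (simp add: A_def)
    have V2: "tail_integral (\<lambda>t. 2 * ((1 + bose (2 * t)) * bose ((u + 1) * t))) \<epsilon>
      = A ((u + 1) / 2) (2 * \<epsilon>) + tail_integral (\<lambda>t. bose t / t) ((u + 1) * \<epsilon>)
        + tail_integral bose ((u + 1) * \<epsilon>) / (u + 1)"
    proof -
      have s: "(u + 1) / 2 * (2 * \<epsilon>) = (u + 1) * \<epsilon>" by simp
      have r: "2 * ((p + q + b / (2 * ((u + 1) / 2))) / 2) = p + q + b / (u + 1)" for p q b
        using u by (simp add: divide_simps) algebra
      show ?thesis
        unfolding set_integral_mult_right bose_product_rescale(2)[OF zero_less_numeral \<epsilon> pos(1)]
          bose_product_tail_integral(2)[OF pos(6) pos(3)] A_def[symmetric] s r ..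
    qed
    have V3: "tail_integral (\<lambda>t. 2 * ((1 + bose (2 * u * t)) * bose ((u + 1) * t))) \<epsilon>
      = A ((u + 1) / (2 * u)) (2 * u * \<epsilon>) / u + tail_integral (\<lambda>t. bose t / t) ((u + 1) * \<epsilon>) / u
        + tail_integral bose ((u + 1) * \<epsilon>) / (u + 1)"
    proof -
      have s: "(u + 1) / (2 * u) * (2 * u * \<epsilon>) = (u + 1) * \<epsilon>" using u by simp
      have r: "2 * ((p + q + b / (2 * ((u + 1) / (2 * u)))) / (2 * u)) = p / u + q / u + b / (u + 1)" for p q b
        using u by (simp add: divide_simps) algebra
      show ?thesis
        unfolding set_integral_mult_right bose_product_rescale(2)[OF pos(2) \<epsilon> pos(1)]
          bose_product_tail_integral(2)[OF pos(7) pos(4)] A_def[symmetric] s r ..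
    qed
    have V4: "tail_integral (\<lambda>t. 2 * bose ((u + 1) * t)) \<epsilon> = 2 * (tail_integral bose ((u + 1) * \<epsilon>) / (u + 1))"
      unfolding set_integral_mult_right tail_integral_scale[OF pos(1), where h = bose] ..
    have V5: "tail_integral (\<lambda>t. 2 * bose (2 * u * t)) \<epsilon> = tail_integral bose (2 * u * \<epsilon>) / u"
      unfolding set_integral_mult_right tail_integral_scale[OF pos(2), where h = bose] by simp
    have "tail_integral K \<epsilon> = tail_integral (\<lambda>t. (1 + bose (1 * t)) * bose (u * t)
        - 2 * ((1 + bose (2 * t)) * bose ((u + 1) * t)) - 2 * ((1 + bose (2 * u * t)) * bose ((u + 1) * t))
        + (2 * bose ((u + 1) * t) - 2 * bose (2 * u * t))) \<epsilon>"
      unfolding K_def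
      by (rule set_lebesgue_integral_cong, simp, intro allI impI parity_integrand_decomposition u) (use \<epsilon> in auto)
    also have "\<dots> = tail_integral (\<lambda>t. (1 + bose (1 * t)) * bose (u * t)) \<epsilon>
        - tail_integral (\<lambda>t. 2 * ((1 + bose (2 * t)) * bose ((u + 1) * t))) \<epsilon>
        - tail_integral (\<lambda>t. 2 * ((1 + bose (2 * u * t)) * bose ((u + 1) * t))) \<epsilon>
        + (tail_integral (\<lambda>t. 2 * bose ((u + 1) * t)) \<epsilon> - tail_integral (\<lambda>t. 2 * bose (2 * u * t)) \<epsilon>)"
      unfolding set_integral_add(2)[OF set_integral_diff(1)[OF set_integral_diff(1)[OF I1 I2] I3] set_integral_diff(1)[OF I4 I5]]
        set_integral_diff(2)[OF set_integral_diff(1)[OF I1 I2] I3] set_integral_diff(2)[OF I1 I2]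
        set_integral_diff(2)[OF I4 I5] ..
    also have "\<dots> = A u \<epsilon> - A ((u + 1) / 2) (2 * \<epsilon>) - A ((u + 1) / (2 * u)) (2 * u * \<epsilon>) / u
        + tail_integral (\<lambda>t. bose t / t) (u * \<epsilon>) - (1 + 1 / u) * tail_integral (\<lambda>t. bose t / t) ((u + 1) * \<epsilon>)
        + tail_integral bose (u * \<epsilon>) / (2 * u) - tail_integral bose (2 * u * \<epsilon>) / u"
      unfolding V1 V2 V3 V4 V5 by (simp add: algebra_simps)
    also have "\<dots> = R \<epsilon> + ((1 / (u * \<epsilon>) + ln (u * \<epsilon>) / 2)
        - (1 + 1 / u) * (1 / ((u + 1) * \<epsilon>) + ln ((u + 1) * \<epsilon>) / 2)
        - ln (u * \<epsilon>) / (2 * u) + ln (2 * u * \<epsilon>) / u)"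
      unfolding R_def G_def H_def by (simp add: ring_distribs diff_divide_distrib add_divide_distrib)
    also have "(1 / (u * \<epsilon>) + ln (u * \<epsilon>) / 2)
        - (1 + 1 / u) * (1 / ((u + 1) * \<epsilon>) + ln ((u + 1) * \<epsilon>) / 2)
        - ln (u * \<epsilon>) / (2 * u) + ln (2 * u * \<epsilon>) / u = ?E"
    proof -
      have ln: "ln (u * \<epsilon>) = ln u + ln \<epsilon>" "ln ((u + 1) * \<epsilon>) = ln (u + 1) + ln \<epsilon>"
        "ln (2 * u * \<epsilon>) = ln 2 + ln u + ln \<epsilon>"
        using u \<epsilon> by (simp_all add: ln_mult)
      define k where "k = 1 / ((u + 1) * \<epsilon>)"
      have k: "1 / (u * \<epsilon>) = (1 + 1 / u) * k"
        using u \<epsilon> by (simp add: k_def divide_simps)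
      show ?thesis
        unfolding ln k k_def[symmetric] using u by (simp add: field_simps)
    qed
    finally show ?thesis by simp
  qed
  have "((\<lambda>\<epsilon>. R \<epsilon> + ?E) \<longlongrightarrow> (herglotz_kernel_integral u - herglotz_kernel_integral ((u + 1) / 2)
      - herglotz_kernel_integral ((u + 1) / (2 * u)) / u
      + c - (1 + 1 / u) * c + 0 / (2 * u) - 0 / u) + ?E) (at_right 0)"
    unfolding R_def by (intro tendsto_intros A_lim H_lim G_lim) (use u in auto)
  moreover have "\<forall>\<^sub>F \<epsilon> in at_right 0. R \<epsilon> + ?E = tail_integral K \<epsilon>"
    using eventually_at_right_less[of 0] by eventually_elim (rule eq)
  ultimately have "(tail_integral K \<longlongrightarrow> (herglotz_kernel_integral u - herglotz_kernel_integral ((u + 1) / 2)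
      - herglotz_kernel_integral ((u + 1) / (2 * u)) / u
      + c - (1 + 1 / u) * c + 0 / (2 * u) - 0 / u) + ?E) (at_right 0)"
    by (rule Lim_transform_eventually)
  from tendsto_unique[OF trivial_limit_at_right_real tail_integral_tendsto[OF K_int] this]
  show ?thesis unfolding K_def by (simp add: algebra_simps)
qed

section \<open>The evaluation of J1\<close>

lemma P_tilde_of_real:
  assumes y: "0 < y" and xy: "y < x"
  shows "P_tilde (of_real x) (of_real y) = of_real (herglotz_kernel_integral y - herglotz_kernel_integral x
    - (ln x - ln y) / 2 - (x - y) / (2 * x * y) * (euler_mascheroni + ln (x - y) - ln x - ln y))"
proof -
  have x: "x > 0" using y xy by simp
  let ?F = "\<lambda>z. - herglotz_kernel_integral z - 1 / 2 * (euler_mascheroni - ln (2 * pi / z))"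
  have "ln (complex_of_real ((x - y) / (x * y))) = of_real (ln ((x - y) / (x * y)))"
    by (rule Ln_of_real) (use x y xy in simp)
  moreover have "ln ((x - y) / (x * y)) = ln (x - y) - ln x - ln y"
    using x y xy by (simp add: ln_divide_pos ln_mult)
  ultimately have L: "ln ((complex_of_real x - of_real y) / (of_real x * of_real y))
      = of_real (ln (x - y) - ln x - ln y)"
    by (simp flip: of_real_diff of_real_mult of_real_divide)
  have "P_tilde (of_real x) (of_real y)
      = of_real (?F x - ?F y - (x - y) / (2 * x * y) * (euler_mascheroni + (ln (x - y) - ln x - ln y)))"
    unfolding P_tilde_def herglotz_F1_of_real[OF x] herglotz_F1_of_real[OF y] L by simp
  also have "ln (2 * pi / x) = ln (2 * pi) - ln x"
    using x by (simp add: ln_divide_pos)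
  also have "ln (2 * pi / y) = ln (2 * pi) - ln y"
    using y by (simp add: ln_divide_pos)
  finally show ?thesis
    by (simp add: diff_divide_distrib)
qed

text \<open>
  With \<open>a = (u + 1) / 2\<close> and \<open>b = (u + 1) / (2u)\<close>, the arguments in \<open>C_comb\<close> are \<open>u\<close>, \<open>a\<close>, \<open>b\<close> and
  their inverses. The inversion turns the first \<open>P_tilde\<close> into \<open>(u - 1) A(u)\<close> plus elementary
  terms, and the sum of the other two into \<open>(a - 1) A(a) + (1 - b) A(b)\<close>, where \<open>a - 1 = (u - 1) / 2\<close>
  and \<open>1 - b = (u - 1) / (2u)\<close>. With the factor \<open>-2\<close> of the latter, \<open>C_comb u / (u - 1)\<close> is the combination of the parity splitting,
  up to elementary terms.
\<close>

lemma calJ1_of_real_gt_1: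
  fixes u :: real
  assumes u: "u > 1"
  defines "z \<equiv> complex_of_real u"
  shows "calJ1 z = 1 / (z - 1) * C_comb z - 2 * euler_mascheroni / (z + 1)
           + (z\<^sup>2 + 1) / (z * (z + 1)) * ln 2 - 2 / (z + 1) * ln ((z - 1) / (z + 1))"
proof -
  obtain c where c: "((\<lambda>\<epsilon>. tail_integral (\<lambda>t. bose t / t) \<epsilon> - 1 / \<epsilon> - ln \<epsilon> / 2) \<longlongrightarrow> c) (at_right 0)"
    using bose_over_t_asymptotics by blast
  define a b where "a = (u + 1) / 2" and "b = (u + 1) / (2 * u)"
  have pos: "u > 0" "a > 0" "b > 0" using u by (auto simp: a_def b_def)
  have inv: "1 / a = 2 / (u + 1)" "1 / b = 2 * u / (u + 1)"
    by (simp_all add: a_def b_def)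
  have order: "1 / u < u" "b < a" "1 / a < 1 / b"
  proof -
    have "1 < u * u" using u by (simp add: less_1_mult)
    thus "1 / u < u" using u by (simp add: divide_less_eq)
    show "b < a" "1 / a < 1 / b"
      using u divide_strict_left_mono[of 2 "2 * u" "u + 1"] unfolding inv unfolding a_def b_def
      by (auto intro!: divide_strict_right_mono)
  qed
  define A where "A = herglotz_kernel_integral"
  define l2 lu lp lm where "l2 = ln (2::real)" and "lu = ln u" and "lp = ln (u + 1)" and "lm = ln (u - 1)"
  define g where "g = (euler_mascheroni :: real)"
  define p where "p x y = A y - A x - (ln x - ln y) / 2 - (x - y) / (2 * x * y) * (g + ln (x - y) - ln x - ln y)" for x y
  have P: "P_tilde (of_real x) (of_real y) = of_real (p x y)" if "0 < y" "y < x" for x y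
    unfolding P_tilde_of_real[OF that] p_def A_def g_def by simp
  have lna: "ln a = lp - l2" "ln b = lp - l2 - lu" "ln (1 / a) = l2 - lp" "ln (1 / b) = l2 + lu - lp" "ln (1 / u) = - lu"
    using u unfolding inv unfolding a_def b_def lp_def l2_def lu_def by (simp_all add: ln_divide_pos ln_mult)
  have lnd: "ln (u - 1 / u) = lm + lp - lu" "ln (a - b) = lm + lp - l2 - lu" "ln (1 / b - 1 / a) = l2 + lm - lp"
  proof -
    have e: "u - 1 / u = (u - 1) * (u + 1) / u" "a - b = (u - 1) * (u + 1) / (2 * u)" "1 / b - 1 / a = 2 * (u - 1) / (u + 1)"
      using u unfolding inv unfolding a_def b_def by (simp_all add: divide_simps) algebra+
    show "ln (u - 1 / u) = lm + lp - lu" "ln (a - b) = lm + lp - l2 - lu" "ln (1 / b - 1 / a) = l2 + lm - lp"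
      using u unfolding e lm_def lp_def l2_def lu_def
      by (simp_all add: ln_divide_pos ln_mult del: right_diff_distrib_numeral)
  qed
  \<comment> \<open>The inversion eliminates the values of \<open>A\<close> at \<open>1 / u\<close>, \<open>1 / a\<close> and \<open>1 / b\<close>. Afterwards \<open>A u\<close>, \<open>A a\<close>,
      \<open>A b\<close>, \<open>c\<close>, \<open>g\<close> and the four logarithms are independent unknowns in a rational identity in \<open>u\<close>.\<close>
  have Ainv: "A (1 / x) = x * A x - c * (1 - x) + ln x / 2 * (x + 1)" if "x > 0" for x
  proof -
    have "x * (A x - A (1 / x) / x) = x * (c * (1 / x - 1) - ln x / 2 * (1 + 1 / x))"
      using herglotz_kernel_inversion[OF c that] by (simp add: A_def)
    moreover have "x * (A x - A (1 / x) / x) = x * A x - A (1 / x)"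
      using that by (simp add: right_diff_distrib)
    moreover have "x * (c * (1 / x - 1) - ln x / 2 * (1 + 1 / x)) = c * (1 - x) - ln x / 2 * (x + 1)"
      using that by (simp add: field_simps)
    ultimately show ?thesis by linarith
  qed
  define J where "J = tail_integral (\<lambda>t. 1 / ((1 + exp (- t)) * (1 + exp (u * t)))) 0"
  have J: "J = A u - A a - A b / u - c / u + (lu - lp) / 2 * (1 + 1 / u) + l2 / u"
    using parity_integral_decomposition[OF c pos(1)] unfolding J_def A_def a_def b_def lu_def lp_def l2_def .
  have "J1 z = of_real J"
    unfolding J1_def z_def J_def set_integral_complex_of_real[symmetric] by (simp flip: exp_of_real)
  hence calJ: "calJ1 z = of_real (J + l2)"
    using Ln_of_real[of 2] by (simp add: calJ1_def l2_def)
  have C: "C_comb z = of_real (p u (1 / u) - 2 * p a b - 2 * p (1 / b) (1 / a))"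
    using P[OF _ order(1)] P[OF _ order(2)] P[OF _ order(3)] u pos
    unfolding C_comb_def z_def inv unfolding a_def b_def by simp
  have real: "J + l2 = 1 / (u - 1) * (p u (1 / u) - 2 * p a b - 2 * p (1 / b) (1 / a)) - 2 * g / (u + 1)
      + (u\<^sup>2 + 1) / (u * (u + 1)) * l2 - 2 / (u + 1) * (lm - lp)"
  proof -
    have nz: "u \<noteq> 0" "u - 1 \<noteq> 0" "u + 1 \<noteq> 0" using u by auto
    have q: "p u (1 / u) = u * A u - c * (1 - u) + lu / 2 * (u + 1) - A u - lu - (u - 1 / u) / 2 * (g + lm + lp - lu)"
      unfolding p_def lnd lna Ainv[OF pos(1)] using u by (simp add: lu_def[symmetric] add.assoc)
    have qab: "p a b = A b - A a - lu / 2 - (1 / b - 1 / a) / 2 * (g + lm + l2 - lp)"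
    proof -
      have "(a - b) / (2 * a * b) = (1 / b - 1 / a) / 2" using pos by (simp add: field_simps)
      moreover have "ln a - ln b = lu" "g + ln (a - b) - ln a - ln b = g + lm + l2 - lp"
        unfolding lnd lna by simp_all
      ultimately show ?thesis by (simp only: p_def)
    qed
    have qba: "p (1 / b) (1 / a) = (a * A a - c * (1 - a) + (lp - l2) / 2 * (a + 1))
        - (b * A b - c * (1 - b) + (lp - l2 - lu) / 2 * (b + 1)) - lu / 2 - (a - b) / 2 * (g + lm + lp - l2 - lu)"
    proof -
      have "(1 / b - 1 / a) / (2 * (1 / b) * (1 / a)) = (a - b) / 2" using pos by (simp add: field_simps)
      moreover have "ln (1 / b) - ln (1 / a) = lu"
        "g + ln (1 / b - 1 / a) - ln (1 / b) - ln (1 / a) = g + lm + lp - l2 - lu"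
        unfolding lnd lna by simp_all
      moreover have "A (1 / a) = a * A a - c * (1 - a) + (lp - l2) / 2 * (a + 1)"
        "A (1 / b) = b * A b - c * (1 - b) + (lp - l2 - lu) / 2 * (b + 1)"
        using Ainv[OF pos(2)] Ainv[OF pos(3)] unfolding lna .
      ultimately show ?thesis by (simp only: p_def)
    qed
    show ?thesis
      unfolding J q qab qba unfolding inv unfolding a_def b_def using nz by (simp add: divide_simps) algebra
  qed
  have "ln ((z - 1) / (z + 1)) = of_real (ln ((u - 1) / (u + 1)))"
    using Ln_of_real[of "(u - 1) / (u + 1)"] u by (simp add: z_def)
  also have "ln ((u - 1) / (u + 1)) = lm - lp"
    using u by (simp add: lm_def lp_def ln_divide_pos)
  finally have l: "ln ((z - 1) / (z + 1)) = of_real (lm - lp)" .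
  have "ln (2 :: complex) = of_real l2"
    using Ln_of_real[of 2] by (simp add: l2_def)
  thus ?thesis
    unfolding calJ real C l by (simp add: z_def g_def)
qed

theorem proposition4p7:
  fixes n :: nat and u :: complex
  assumes "n \<ge> 1" and "even n"
    and "u = of_real (real n + sqrt ((real n)\<^sup>2 - 1))"
  shows "calJ1 u = 1 / (u - 1) * C_comb u - 2 * euler_mascheroni / (u + 1)
           + (u\<^sup>2 + 1) / (u * (u + 1)) * ln 2 - 2 / (u + 1) * ln ((u - 1) / (u + 1))"
proof -
  have "n \<ge> 2" using assms(1,2) by (cases "n = 1") auto
  hence "real n \<ge> 2" by simp
  moreover have "sqrt ((real n)\<^sup>2 - 1) \<ge> 0"
    using \<open>real n \<ge> 2\<close> by simp
  ultimately have "real n + sqrt ((real n)\<^sup>2 - 1) > 1" by linarith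
  from calJ1_of_real_gt_1[OF this] show ?thesis unfolding assms(3) .
qed

end
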